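(* Let $S$ be a finite semigroup. Then the dual Cayley automaton semigroup $\mathbf{C}^{\ast}(S)$ is finite if and only if $S$ is $\mathcal{H}$-trivial and $S$ does not contain non-trivial right zero subsemigroups.
   Context: Semigroups are non-empty. For a finite semigroup $S$, the dual Cayley automaton $\mathcal{C}^{\ast}(S)$ has state set $S$ and alphabet $S$; when it is in state $s$ and reads the symbol $x$, it moves to the state $sx$ and outputs the symbol $xs$. Write $\overline{s}$ for the state corresponding to $s\in S$. Each state $\overline{s}$ defines a transformation of the set $S^{\infty}$ of (right-)infinite sequences over $S$: an input sequence $x_1x_2x_3\cdots$ is sent to the output sequence produced by the automaton started in state $s$, that is, $(x_1x_2x_3\cdots)\cdot\overline{s}=y_1y_2y_3\cdots$ with $y_1=x_1s$ and $y_{i}=x_{i}\,s\,x_1x_2\cdots x_{i-1}$ for $i\ge 2$ (products in $S$). The dual Cayley automaton semigroup $\mathbf{C}^{\ast}(S)$ is the semigroup of transformations of $S^{\infty}$ generated under composition by $\{\overline{s}: s\in S\}$; transformations act on the right, so products are composed from left to right. Two states are equal in $\mathbf{C}^{\ast}(S)$ when they define the same transformation. $S$ is $\mathcal{H}$-trivial if Green's relation $\mathcal{H}$ on $S$ is the equality relation. A right zero semigroup is one in which $xy=y$ for all $x,y$; it is non-trivial if it has more than one element. *)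

theory Defs
  imports Main "HOL-Library.Stream"
begin

text \<open>
  A Mealy automaton with transition function \<open>\<delta>\<close> and output function \<open>\<omega>\<close>, started in state \<open>q\<close>,
  maps an infinite input sequence to an infinite output sequence.
\<close>

primcorec mealy_map :: "('q \<Rightarrow> 'a \<Rightarrow> 'q) \<Rightarrow> ('q \<Rightarrow> 'a \<Rightarrow> 'b) \<Rightarrow> 'q \<Rightarrow> 'a stream \<Rightarrow> 'b stream"
  where
    "mealy_map \<delta> \<omega> q xs = \<omega> q (shd xs) ## mealy_map \<delta> \<omega> (\<delta> q (shd xs)) (stl xs)"

text \<open>
  The semigroup is the whole type; states and symbols are both its elements.
  State \<open>s\<close> reading \<open>x\<close> moves to \<open>s * x\<close> and outputs \<open>x * s\<close>.
\<close>

definition dual_cayley_state :: "'a::semigroup_mult \<Rightarrow> 'a stream \<Rightarrow> 'a stream"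
  where "dual_cayley_state = mealy_map (\<lambda>s x. s * x) (\<lambda>s x. x * s)"

text \<open>
  Transformations act on the right, so the product of \<open>f\<close> and \<open>g\<close> (first \<open>f\<close>, then \<open>g\<close>) is \<open>g \<circ> f\<close>.
\<close>

inductive_set generated_transformations :: "('b \<Rightarrow> 'b) set \<Rightarrow> ('b \<Rightarrow> 'b) set"
  for G :: "('b \<Rightarrow> 'b) set"
  where
    generator: "f \<in> G \<Longrightarrow> f \<in> generated_transformations G"
  | product: "f \<in> generated_transformations G \<Longrightarrow> g \<in> generated_transformations G
      \<Longrightarrow> g \<circ> f \<in> generated_transformations G"

definition dual_cayley_semigroup :: "('a::semigroup_mult stream \<Rightarrow> 'a stream) set"
  where "dual_cayley_semigroup = generated_transformations (range dual_cayley_state)"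

text \<open>
  The principal one-sided ideals \<open>S\<^sup>1 a\<close> and \<open>a S\<^sup>1\<close>; inserting \<open>a\<close> itself accounts for
  the adjoined identity of \<open>S\<^sup>1\<close>.
\<close>

definition principal_left_ideal :: "'a::semigroup_mult \<Rightarrow> 'a set"
  where "principal_left_ideal a = insert a {s * a | s. True}"

definition principal_right_ideal :: "'a::semigroup_mult \<Rightarrow> 'a set"
  where "principal_right_ideal a = insert a {a * s | s. True}"

definition green_L :: "'a::semigroup_mult rel"
  where "green_L = {(a, b). principal_left_ideal a = principal_left_ideal b}"

definition green_R :: "'a::semigroup_mult rel"
  where "green_R = {(a, b). principal_right_ideal a = principal_right_ideal b}"

definition green_H :: "'a::semigroup_mult rel"
  where "green_H = green_L \<inter> green_R"

definition subsemigroup :: "'a::semigroup_mult set \<Rightarrow> bool"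
  where "subsemigroup T \<longleftrightarrow> T \<noteq> {} \<and> (\<forall>x\<in>T. \<forall>y\<in>T. x * y \<in> T)"

definition right_zero :: "'a::semigroup_mult set \<Rightarrow> bool"
  where "right_zero T \<longleftrightarrow> (\<forall>x\<in>T. \<forall>y\<in>T. x * y = y)"

text \<open>
  The closed form of the output; positions are counted from 0, so the entry at position \<open>i\<close>
  is \<open>x\<^sub>i (s x\<^sub>0 x\<^sub>1 \<dots>)\<close>, the last factor being \<open>x\<close> at position \<open>i - 1\<close>.
\<close>

lemma snth_dual_cayley_state:
  "dual_cayley_state s xs !! i = xs !! i * foldl (*) s (stake i xs)"
  unfolding dual_cayley_state_def by (induction i arbitrary: s xs) simp_all

end

theory Submission
  imports Defs "HOL-Library.FuncSet"
begin

text \<open>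
  Adjoin an identity to \<open>S\<close>. Reading an input prefix \<open>u\<close>, a word \<open>w\<close> of states becomes a new word,
  whose product \<open>\<Pi>\<^sub>w(u)\<close> determines the next output letter; so \<open>C\<^sup>*(S)\<close> is finite iff there are finitely
  many functions \<open>\<Pi>\<^sub>w\<close>. If \<open>S\<close> is \<open>\<H>\<close>-trivial and each \<open>\<R>\<close>-class has at most one idempotent (no two
  idempotents form a right zero band), one counts these functions modulo an ideal \<open>I\<close>, descending from
  \<open>S\<close> to the empty ideal one \<open>\<J>\<close>-class \<open>J = I' - I\<close> at a time. The rows of the array of states
  \<open>P\<^sub>q(u)\<close> and of their partial products \<open>\<Pi>\<^sub>q(u)\<close> descend in the \<open>\<R>\<close>-order. A cell of the array that
  stays inside \<open>J\<close> in both directions produces an idempotent, and within a few columns after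
  a row has entered \<open>J\<close>, a surviving state is a fixed idempotent that acts trivially. Hence two
  prefixes of \<open>w\<close> with equal classes modulo \<open>I'\<close> and equal behaviour on these few columns,
  which is finite information, have equal classes modulo \<open>I\<close>, and long words can be shortened.

  Conversely, two elements of a right zero band act as a delay line, and a non-trivial cyclic group
  acts through partial sums, that is, through multiplication by \<open>1 / (1 - t)\<close> on power series; both
  have infinite order.
\<close>

section \<open>Sections of words and collapsing an ideal\<close>

lemma finite_range_factor:
  assumes "finite (range g)" and "\<And>x y. g x = g y \<Longrightarrow> f x = f y"
  shows "finite (range f)"
proof -
  have "f x = f (inv g (g x))" for x
    by (rule assms(2)) (simp add: f_inv_into_f)
  then have "range f \<subseteq> (\<lambda>z. f (inv g z)) ` range g" by blast
  then show ?thesis using assms(1) finite_surj by blast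
qed

text \<open>
  Histories are listed with the most recent letter first: \<open>sect w (x # u)\<close> is the word of states
  reached from \<open>sect w u\<close> by reading \<open>x\<close>.
\<close>

primrec residual :: "'a::semigroup_mult \<Rightarrow> 'a list \<Rightarrow> 'a list"
  where
    "residual x [] = []"
  | "residual x (s # w) = s * x # residual (x * s) w"

definition sect :: "'a::semigroup_mult list \<Rightarrow> 'a list \<Rightarrow> 'a list"
  where "sect w u = foldr residual u w"

definition sect_prod :: "'a::monoid_mult list \<Rightarrow> 'a list \<Rightarrow> 'a"
  where "sect_prod w u = prod_list (sect w u)"

text \<open>
  \<open>row s m u\<close> is the state reached from \<open>s\<close> on history \<open>u\<close> when it is fed the output of a word whose
  products are given by \<open>m\<close>.
\<close>

primrec row :: "'a::semigroup_mult \<Rightarrow> ('a list \<Rightarrow> 'a) \<Rightarrow> 'a list \<Rightarrow> 'a"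
  where
    "row s m [] = s"
  | "row s m (x # u) = row s m u * x * m u"

lemma length_residual [simp]: "length (residual x w) = length w"
  by (induction w arbitrary: x) auto

lemma take_residual: "take q (residual x w) = residual x (take q w)"
  by (induction w arbitrary: x q) (auto simp: take_Cons split: nat.splits)

lemma nth_residual:
  fixes x :: "'a::monoid_mult"
  shows "q < length w \<Longrightarrow> residual x w ! q = w ! q * x * prod_list (take q w)"
  by (induction w arbitrary: x q) (auto simp: nth_Cons mult.assoc split: nat.splits)

lemma sect_Nil [simp]: "sect w [] = w"
  by (simp add: sect_def)

lemma sect_Cons [simp]: "sect w (x # u) = residual x (sect w u)"
  by (simp add: sect_def)

lemma sect_append: "sect w (y @ v) = sect (sect w v) y"
  by (simp add: sect_def)

lemma length_sect [simp]: "length (sect w u) = length w"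
  by (induction u) auto

lemma take_sect: "take q (sect w u) = sect (take q w) u"
  by (induction u) (auto simp: take_residual)

lemma sect_prod_append: "sect_prod w (y @ v) = sect_prod (sect w v) y"
  by (simp add: sect_prod_def sect_append)

lemma nth_sect_Cons:
  "q < length w \<Longrightarrow> sect w (x # u) ! q = sect w u ! q * x * sect_prod (take q w) u"
  by (simp add: nth_residual sect_prod_def take_sect)

lemma nth_sect:
  "q < length w \<Longrightarrow> sect w u ! q = row (w ! q) (sect_prod (take q w)) u"
  by (induction u) (auto simp: nth_residual sect_prod_def take_sect)

lemma sect_prod_take_Suc:
  assumes "q < length w"
  shows "sect_prod (take (Suc q) w) u = sect_prod (take q w) u * sect w u ! q"
proof -
  have "take (Suc q) (sect w u) = take q (sect w u) @ [sect w u ! q]"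
    using assms by (simp add: take_Suc_conv_app_nth)
  then show ?thesis by (simp add: sect_prod_def flip: take_sect)
qed

lemma sect_prod_snoc: "sect_prod (w @ [s]) u = sect_prod w u * row s (sect_prod w) u"
  using sect_prod_take_Suc[of "length w" "w @ [s]" u] nth_sect[of "length w" "w @ [s]" u] by simp

section \<open>Ideals and products modulo an ideal\<close>

definition ideal :: "'a::semigroup_mult set \<Rightarrow> bool"
  where "ideal I \<longleftrightarrow> (\<forall>a\<in>I. \<forall>x. x * a \<in> I \<and> a * x \<in> I)"

text \<open>The Rees quotient by \<open>I\<close>, realised inside the type by sending all of
  \<open>I\<close> to one chosen element. For \<open>I = {}\<close> it is the identity, so the
  descent through ideals ends with exact products.\<close>

definition collapse :: "'a set \<Rightarrow> 'a \<Rightarrow> 'a"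
  where "collapse I a = (if a \<in> I then SOME z. z \<in> I else a)"

lemma collapse_in_iff: "collapse I a \<in> I \<longleftrightarrow> a \<in> I"
  by (auto simp: collapse_def intro: someI)

lemma collapse_eq_iff: "collapse I a = collapse I b \<longleftrightarrow> a = b \<or> a \<in> I \<and> b \<in> I"
  using collapse_in_iff[of I a] collapse_in_iff[of I b] by (auto simp: collapse_def)

lemma collapse_idem: "collapse I (collapse I a) = collapse I a"
  by (simp add: collapse_in_iff collapse_def)

lemma collapse_mult:
  assumes "ideal I" "collapse I a = collapse I a'" "collapse I b = collapse I b'"
  shows "collapse I (a * b) = collapse I (a' * b')"
  using assms unfolding collapse_eq_iff ideal_def by blast

lemma collapse_row:
  assumes "ideal I" "\<And>u. collapse I (m u) = collapse I (m' u)"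
  shows "collapse I (row s m u) = collapse I (row s m' u)"
  by (induction u) (auto intro!: collapse_mult assms)

definition collapsed_prod :: "'a::monoid_mult set \<Rightarrow> 'a list \<Rightarrow> 'a list \<Rightarrow> 'a"
  where "collapsed_prod I w u = collapse I (sect_prod w u)"

lemma collapsed_prod_eqD:
  assumes "collapsed_prod I w = collapsed_prod I w'"
  shows "sect_prod w u \<in> I \<longleftrightarrow> sect_prod w' u \<in> I"
    and "sect_prod w u \<notin> I \<Longrightarrow> sect_prod w u = sect_prod w' u"
proof -
  have eq: "collapse I (sect_prod w u) = collapse I (sect_prod w' u)"
    using fun_cong[OF assms, of u] by (simp add: collapsed_prod_def)
  show "sect_prod w u \<in> I \<longleftrightarrow> sect_prod w' u \<in> I"
    using arg_cong[OF eq, of "\<lambda>a. a \<in> I"] by (simp add: collapse_in_iff)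
  show "sect_prod w u \<notin> I \<Longrightarrow> sect_prod w u = sect_prod w' u"
    using eq by (simp add: collapse_eq_iff)
qed

text \<open>A further letter sees the word before it only through its products, and multiplication
  respects classes modulo \<open>I\<close>. This right congruence allows a factor to be cut out of a
  word when the prefixes ending at its two ends agree.\<close>

lemma collapsed_prod_append:
  assumes "ideal I" "collapsed_prod I w = collapsed_prod I w'"
  shows "collapsed_prod I (w @ z) = collapsed_prod I (w' @ z)"
proof (induction z rule: rev_induct)
  case (snoc s z)
  have "collapse I (sect_prod (w @ z) u) = collapse I (sect_prod (w' @ z) u)" for u
    using fun_cong[OF snoc, of u] by (simp add: collapsed_prod_def)
  then show ?case
    by (auto simp: collapsed_prod_def sect_prod_snoc simp flip: append_assoc
        intro!: ext collapse_mult collapse_row assms)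
qed (simp add: assms)

text \<open>
  A word together with, for every letter, the class modulo \<open>I\<close> of the prefix before it: where the
  section of the word has product outside \<open>I\<close>, it is obtained letter by letter.
\<close>

definition annotate :: "'a::monoid_mult set \<Rightarrow> 'a list \<Rightarrow> ('a \<times> ('a list \<Rightarrow> 'a)) list"
  where "annotate I w = map (\<lambda>q. (w ! q, collapsed_prod I (take q w))) [0..<length w]"

lemma map_row_annotate:
  assumes "ideal I" "v = [] \<or> sect_prod w v \<notin> I"
  shows "map (\<lambda>(s, m). row s m v) (annotate I w) = sect w v"
proof (rule nth_equalityI)
  fix q assume "q < length (map (\<lambda>(s, m). row s m v) (annotate I w))"
  then have q: "q < length w" by (simp add: annotate_def)
  have "row (w ! q) (collapsed_prod I (take q w)) v = sect w v ! q"
  \<comment> \<open>On the empty history a row is its starting letter whatever \<open>m\<close> is;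
    otherwise the state must be shown to lie outside \<open>I\<close>, where its class determines
    it.\<close>
  proof (cases "v = []")
    case False
    have "sect w v = take q (sect w v) @ sect w v ! q # drop (Suc q) (sect w v)"
      using q by (intro id_take_nth_drop) simp
    from arg_cong[OF this, of prod_list]
    have "sect_prod w v = prod_list (take q (sect w v)) * (sect w v ! q * prod_list (drop (Suc q) (sect w v)))"
      unfolding sect_prod_def prod_list.append prod_list.Cons .
    moreover have "x * (b * y) \<in> I" if "b \<in> I" for x b y
      using assms(1) that by (simp add: ideal_def)
    ultimately have "sect w v ! q \<notin> I" using assms(2) False by auto
    moreover have "collapse I (row (w ! q) (collapsed_prod I (take q w)) v)
        = collapse I (row (w ! q) (sect_prod (take q w)) v)"
      by (rule collapse_row) (auto simp: assms collapsed_prod_def collapse_idem)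
    ultimately show ?thesis using q by (auto simp: collapse_eq_iff nth_sect)
  qed (use q in simp)
  then show "map (\<lambda>(s, m). row s m v) (annotate I w) ! q = sect w v ! q"
    using q by (simp add: annotate_def)
qed (simp add: annotate_def)

text \<open>
  \<open>D\<close> tabulates the products after up to \<open>n\<close> letters for every way \<open>\<alpha>\<close> of turning annotated letters
  into states. The history \<open>v\<close> enters only through \<open>\<alpha>\<close>, which ranges over a finite set.
\<close>

lemma finite_index_extensions:
  fixes I :: "'a::{finite,monoid_mult} set"
  assumes "ideal I" "finite (range (collapsed_prod I))"
  obtains D :: "'a list \<Rightarrow> ((('a \<times> ('a list \<Rightarrow> 'a)) \<Rightarrow> 'a) \<times> 'a list) \<Rightarrow> 'a"
  where "finite (range D)"
    and "\<And>w w' v y. D w = D w' \<Longrightarrow> v = [] \<or> sect_prod w v \<notin> I \<and> sect_prod w' v \<notin> I \<Longrightarrow> length y \<le> n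
      \<Longrightarrow> sect_prod w (y @ v) = sect_prod w' (y @ v)"
proof
  define A where "A = (UNIV :: 'a set) \<times> range (collapsed_prod I)"
  define F where "F = (A \<rightarrow>\<^sub>E (UNIV :: 'a set)) \<times> {y :: 'a list. length y \<le> n}"
  \<comment> \<open>Restricting to the finite domain \<open>F\<close> keeps \<open>D w\<close>
    within a finite function space.\<close>
  define D where "D w = restrict (\<lambda>(\<alpha>, y). sect_prod (map \<alpha> (annotate I w)) y) F" for w
  have "finite A" unfolding A_def using assms by simp
  then have "finite F"
    unfolding F_def using finite_lists_length_le[of "UNIV :: 'a set" n] by (auto intro!: finite_cartesian_product finite_PiE)
  then have "finite (F \<rightarrow>\<^sub>E (UNIV :: 'a set))" by (intro finite_PiE) auto
  moreover have "range D \<subseteq> F \<rightarrow>\<^sub>E UNIV" unfolding D_def by auto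
  ultimately show "finite (range D)" by (rule finite_subset[rotated])
  fix w w' v y :: "'a list"
  assume eq: "D w = D w'" and v: "v = [] \<or> sect_prod w v \<notin> I \<and> sect_prod w' v \<notin> I" and y: "length y \<le> n"
  define \<alpha> where "\<alpha> = restrict (\<lambda>(s, m). row s m v) A"
  have in_F: "(\<alpha>, y) \<in> F" unfolding F_def \<alpha>_def using y by auto
  have "map \<alpha> (annotate I z) = map (\<lambda>(s, m). row s m v) (annotate I z)" for z
    by (auto simp: annotate_def \<alpha>_def A_def)
  then have "D z (\<alpha>, y) = sect_prod z (y @ v)" if "v = [] \<or> sect_prod z v \<notin> I" for z
    using in_F map_row_annotate[OF assms(1) that]
    by (simp add: D_def sect_prod_append del: map_eq_conv)
  then show "sect_prod w (y @ v) = sect_prod w' (y @ v)" using v eq by metis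
qed

section \<open>One J-class between two ideals\<close>

locale aperiodic_R_unipotent =
  fixes type :: "'a::{finite,monoid_mult} itself"
  assumes aperiodic: "\<exists>n. (x :: 'a) ^ n = x ^ Suc n"
    and R_unipotent: "(e :: 'a) * e = e \<Longrightarrow> f * f = f \<Longrightarrow> e * f = f \<Longrightarrow> f * e = e \<Longrightarrow> e = f"
begin

lemma iterate_two_sided:
  assumes "(a :: 'a) = s * a * t"
  shows "a = s ^ k * a * t ^ k"
proof (induction k)
  case (Suc k)
  have "s ^ Suc k * a * t ^ Suc k = s ^ k * (s * a * t) * t ^ k"
    by (simp only: power_Suc2[of s] power_Suc[of t] mult.assoc)
  then show ?case using assms Suc by simp
qed simp

text \<open>Iteration gives \<open>a = s ^ k * a * t ^ k\<close>, and as soon as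
  \<open>t ^ k = t ^ Suc k\<close> one more factor \<open>t\<close> changes nothing.\<close>

lemma absorb_right: "(a :: 'a) = s * a * t \<Longrightarrow> a * t = a"
  using aperiodic[of t] iterate_two_sided[of a s t] by (metis mult.assoc power_Suc2)

lemma absorb_left: "(a :: 'a) = s * a * t \<Longrightarrow> s * a = a"
  using aperiodic[of s] iterate_two_sided[of a s t] by (metis mult.assoc power_Suc)

lemma aperiodic_idempotent:
  obtains n where "(x :: 'a) ^ Suc n * x ^ Suc n = x ^ Suc n"
proof -
  obtain n where n: "x ^ Suc n = x ^ n" using aperiodic by metis
  have "x ^ (n + k) = x ^ n" for k by (induction k) (use n in simp_all)
  from this[of n] have "x ^ Suc n * x ^ Suc n = x ^ Suc n"
    unfolding n power_add .
  then show ?thesis by (rule that)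
qed

end

locale J_layer = aperiodic_R_unipotent type for type :: "'a::{finite,monoid_mult} itself" +
  fixes I I' :: "'a set"
  assumes ideal: "ideal I" and ideal': "ideal I'"
    and J_equivalent: "a \<in> I' \<Longrightarrow> a \<notin> I \<Longrightarrow> b \<in> I' \<Longrightarrow> b \<notin> I \<Longrightarrow> \<exists>s t. a = s * b * t"
begin

lemma in_I: "a \<in> I \<Longrightarrow> x * a \<in> I" "a \<in> I \<Longrightarrow> a * x \<in> I"
  using ideal by (auto simp: ideal_def)

lemma in_I': "a \<in> I' \<Longrightarrow> x * a \<in> I'" "a \<in> I' \<Longrightarrow> a * x \<in> I'"
  using ideal' by (auto simp: ideal_def)

text \<open>Stability: a product that stays in the layer is R-related to its left factor.
  J-equivalence gives \<open>a = s * a * (b * t)\<close>, and absorption removes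
  \<open>s\<close>.\<close>

lemma R_stable:
  assumes "a \<in> I'" "a * b \<notin> I"
  obtains t where "a * b * t = a"
proof -
  obtain s t where "a = s * (a * b) * t"
    using J_equivalent[of a "a * b"] assms in_I in_I' by blast
  then show ?thesis using absorb_right[of a s "b * t"] that by (simp add: mult.assoc)
qed

lemma L_stable:
  assumes "a \<in> I'" "b * a \<notin> I"
  obtains s where "s * (b * a) = a"
proof -
  obtain s t where "a = s * (b * a) * t"
    using J_equivalent[of a "b * a"] assms in_I in_I' by blast
  then show ?thesis using absorb_left[of a "s * b" t] that by (simp add: mult.assoc)
qed

text \<open>Stability recovers both factors, \<open>p = p * y * u\<close> and
  \<open>y = y * p * v\<close>; so \<open>p = p * y * p * (v * u)\<close>, and absorption yields
  \<open>p * y * p = p\<close>.\<close>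

lemma cell_idempotent:
  assumes "p \<in> I'" "y \<in> I'" "p * y \<notin> I" "y * p \<notin> I"
  shows "p * y * (p * y) = p * y"
proof -
  obtain u where u: "p * y * u = p" using R_stable assms by metis
  obtain v where v: "y * p * v = y" using R_stable assms by metis
  have "p = p * y * p * (v * u)" using u v by (metis mult.assoc)
  then have "p * y * p = p" by (rule absorb_left)
  then show ?thesis by (metis mult.assoc)
qed

text \<open>By stability \<open>e\<close> and \<open>e * f\<close> are R-related, and an R-class
  holds at most one idempotent.\<close>

lemma idempotent_unique:
  assumes "e \<in> I'" "e * e = e" "f * f = f" "f \<notin> I" "e * f = f"
  shows "e = f"
proof -
  obtain t where "e * f * t = e" using R_stable assms by metis
  then have "f * e = e" using assms by (metis mult.assoc)
  then show ?thesis using R_unipotent assms by blast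
qed

text \<open>If \<open>g * e * v = g\<close>, an idempotent power \<open>f\<close> of
  \<open>e * v\<close> also fixes \<open>g\<close>, hence lies outside \<open>I\<close>; since
  \<open>e * f = f\<close>, uniqueness gives \<open>f = e\<close>.\<close>

lemma idempotent_right_unit:
  assumes "g \<in> I'" "e \<in> I'" "e * e = e" "g * e \<notin> I"
  shows "g * e = g"
proof -
  obtain v where v: "g * e * v = g" using R_stable assms by metis
  obtain n where n: "(e * v) ^ Suc n * (e * v) ^ Suc n = (e * v) ^ Suc n"
    by (rule aperiodic_idempotent)
  define f where "f = (e * v) ^ Suc n"
  have "g * (e * v) ^ k = g" for k
    by (induction k) (use v in \<open>simp_all add: mult.assoc[symmetric]\<close>)
  then have gf: "g * f = g" unfolding f_def .
  moreover have "g \<notin> I" using assms in_I by blast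
  ultimately have "f \<notin> I" using in_I by metis
  moreover have "e * f = f" by (simp add: f_def assms(3) flip: mult.assoc)
  ultimately have "e = f" using idempotent_unique assms n unfolding f_def by blast
  then show ?thesis using gf by simp
qed

end

text \<open>
  \<open>P i q\<close> is the state of row \<open>q\<close> after \<open>i\<close> letters and \<open>Q i q\<close> the product of the states of the rows
  before \<open>q\<close>. The cell at \<open>(i, q)\<close> receives \<open>p = P i q\<close> and \<open>y = x i * Q i q\<close> and emits \<open>p * y\<close> to the
  right and \<open>y * p\<close> downwards.
\<close>

locale section_array = J_layer type I I'
  for type :: "'a::{finite,monoid_mult} itself" and I I' :: "'a set" +
  fixes x :: "nat \<Rightarrow> 'a" and P Q :: "nat \<Rightarrow> nat \<Rightarrow> 'a" and n r :: nat
  assumes P_Suc: "q < n \<Longrightarrow> P (Suc i) q = P i q * (x i * Q i q)"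
    and Q_Suc: "q < n \<Longrightarrow> Q i (Suc q) = Q i q * P i q"
    and start: "Q 0 r \<in> I'"
begin

lemma P_multiple: "i \<le> j \<Longrightarrow> q < n \<Longrightarrow> \<exists>z. P j q = P i q * z"
proof (induction j rule: dec_induct)
  case base
  show ?case by (rule exI[of _ 1]) simp
next
  case (step j)
  then obtain z where "P j q = P i q * z" by blast
  then have "P (Suc j) q = P i q * (z * (x j * Q j q))" using P_Suc step by (simp add: mult.assoc)
  then show ?case by blast
qed

lemma Q_multiple: "q \<le> q' \<Longrightarrow> q' \<le> n \<Longrightarrow> \<exists>z. Q i q' = Q i q * z"
proof (induction q' rule: dec_induct)
  case base
  show ?case by (rule exI[of _ 1]) simp
next
  case (step q')
  then obtain z where "Q i q' = Q i q * z" by auto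
  then have "Q i (Suc q') = Q i q * (z * P i q')" using Q_Suc step by (simp add: mult.assoc)
  then show ?case by blast
qed

lemma Q_notin_prefix: "Q i q' \<notin> I \<Longrightarrow> q \<le> q' \<Longrightarrow> q' \<le> n \<Longrightarrow> Q i q \<notin> I"
  using Q_multiple in_I by metis

lemma P_notin:
  assumes "Q l R \<notin> I" "R \<le> n" "q < R" "i \<le> l"
  shows "P i q \<notin> I"
proof -
  have "Q l (Suc q) \<notin> I" using Q_notin_prefix assms by simp
  then have "P l q \<notin> I" using Q_Suc[of q l] assms in_I by auto
  then show ?thesis using P_multiple[of i l q] assms in_I by auto
qed

lemma input_notin:
  assumes "Q l R \<notin> I" "R \<le> n" "q < R" "i < l"
  shows "x i * Q i q \<notin> I"
  using P_notin[OF assms(1-3), of "Suc i"] assms P_Suc[of q i] in_I by auto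

lemma Q_notin:
  assumes "Q l R \<notin> I" "R \<le> n" "q < R" "i \<le> l"
  shows "Q i q \<notin> I"
  using input_notin[OF assms(1-3), of i] Q_notin_prefix[OF assms(1), of q] assms in_I
  by (cases "i = l") auto

lemma P_in:
  assumes "1 \<le> i" "r \<le> q" "q < n"
  shows "P i q \<in> I'"
proof -
  have "Q 0 q \<in> I'" using Q_multiple[of r q 0] start in_I' assms by auto
  then have "P 1 q \<in> I'" using P_Suc[of q 0] assms in_I' by simp
  then show ?thesis using P_multiple[of 1 i q] assms in_I' by auto
qed

lemma Q_in:
  assumes "1 \<le> i" "r < q" "q \<le> n"
  shows "Q i q \<in> I'"
proof -
  have "Q i (Suc r) \<in> I'" using Q_Suc[of r i] P_in[of i r] assms in_I' by simp
  then show ?thesis using Q_multiple[of "Suc r" q i] assms in_I' by auto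
qed

text \<open>\<open>P i q\<close> is what the cell at column \<open>i - 1\<close> emits to the right.
  Its downward output is the input of row \<open>Suc q\<close>, outside \<open>I\<close> because
  that row also precedes \<open>R\<close>; \<open>2 \<le> i\<close> puts both inputs of the cell in
  \<open>I'\<close>.\<close>

lemma inner_idempotent:
  assumes "Q l R \<notin> I" "R \<le> n" "r < q" "Suc q < R" "2 \<le> i" "i \<le> l"
  shows "P i q * P i q = P i q"
proof -
  obtain j where j: "i = Suc j" "1 \<le> j" using assms by (cases i) auto
  have eq: "P i q = P j q * (x j * Q j q)" using P_Suc assms j by simp
  show ?thesis unfolding eq
  proof (rule cell_idempotent)
    show "P j q \<in> I'" "x j * Q j q \<in> I'" using P_in Q_in in_I' assms j by simp_all
    show "P j q * (x j * Q j q) \<notin> I" using P_notin[OF assms(1,2), of q i] eq assms by simp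
    show "x j * Q j q * P j q \<notin> I"
      using input_notin[OF assms(1,2), of "Suc q" j] Q_Suc[of q j] assms j by (simp add: mult.assoc)
  qed
qed

lemma idempotent_constant:
  assumes "Q l R \<notin> I" "R \<le> n" "r < q" "q < R" "2 \<le> i" "i < l"
    and "P i q * P i q = P i q" "P (Suc i) q * P (Suc i) q = P (Suc i) q"
  shows "P (Suc i) q = P i q"
proof (rule idempotent_unique[symmetric])
  show "P i q * P (Suc i) q = P (Suc i) q"
    using P_Suc[of q i] assms by (simp flip: mult.assoc)
qed (use assms P_in[of i q] P_notin[OF assms(1,2), of q "Suc i"] in auto)

text \<open>Row \<open>R - 1\<close> has no surviving row below it to certify its downward output.
  But the row before it has a constant idempotent state \<open>?E\<close> from column 2 on, and by
  L-stability the product of \<open>?E\<close> with the state of row \<open>R - 1\<close> decides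
  whether the partial product leaves the layer. It is outside \<open>I\<close> at column
  \<open>l\<close>, hence also earlier.\<close>

lemma
  assumes R: "Q l R \<notin> I" "R \<le> n" "r + 3 \<le> R"
  shows Q_notin_earlier: "2 \<le> i \<Longrightarrow> i \<le> l \<Longrightarrow> Q i R \<notin> I"
    and P_idempotent: "r < q \<Longrightarrow> q < R \<Longrightarrow> 3 \<le> i \<Longrightarrow> i \<le> l \<Longrightarrow> P i q * P i q = P i q"
proof -
  define a where "a = R - 2"
  have a: "R = Suc (Suc a)" "r < a" using R by (auto simp: a_def)
  let ?E = "P 2 a"
  have E: "P i a = ?E" if "2 \<le> i" "i \<le> l" for i
    using that
  proof (induction i rule: dec_induct)
    case (step i)
    then show ?case
      using idempotent_constant[OF R(1,2), of a i] inner_idempotent[OF R(1,2), of a] a by simp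
  qed simp
  have E_P: "?E * P i (Suc a) \<notin> I" if "2 \<le> i" "i \<le> l" for i
  proof -
    have "Q l R = Q l a * (?E * P l (Suc a))"
      using Q_Suc[of a l] Q_Suc[of "Suc a" l] E[of l] R a that by (simp add: mult.assoc)
    then have "?E * P l (Suc a) \<notin> I" using R(1) in_I(1)[of "?E * P l (Suc a)" "Q l a"] by auto
    moreover obtain z where "P l (Suc a) = P i (Suc a) * z"
      using P_multiple[of i l "Suc a"] \<open>i \<le> l\<close> R a by auto
    ultimately show ?thesis using in_I(2)[of "?E * P i (Suc a)" z] by (auto simp: mult.assoc)
  qed
  have E_in: "?E \<in> I'" using P_in[of 2 a] R a by simp
  have b: "z * (Q i (Suc a) * P i (Suc a)) \<notin> I"
    if "z * Q i (Suc a) \<notin> I" "2 \<le> i" "i \<le> l" for i z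
  proof
    assume *: "z * (Q i (Suc a) * P i (Suc a)) \<in> I"
    have eq: "z * Q i (Suc a) = z * Q i a * ?E"
      using Q_Suc[of a i] E[of i] that R a by (simp add: mult.assoc)
    have "z * Q i a * ?E \<notin> I" using that(1) unfolding eq .
    then obtain s where "s * (z * Q i a * ?E) = ?E" using L_stable[OF E_in] by blast
    then have s: "s * (z * Q i (Suc a)) = ?E" unfolding eq .
    have "?E * P i (Suc a) = s * (z * (Q i (Suc a) * P i (Suc a)))"
      unfolding s[symmetric] by (simp add: mult.assoc)
    then show False using E_P[OF that(2,3)] in_I(1)[OF *] by simp
  qed
  show Q_R: "Q i R \<notin> I" if "2 \<le> i" "i \<le> l" for i
    using b[of 1 i] Q_notin[OF R(1,2), of "Suc a" i] Q_Suc[of "Suc a" i] that a R by simp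
  show "P i q * P i q = P i q" if q: "r < q" "q < R" "3 \<le> i" "i \<le> l" for i q
  proof (cases "Suc q < R")
    case True
    then show ?thesis using inner_idempotent R q by simp
  next
    case False
    then have qa: "q = Suc a" using a q by simp
    obtain j where j: "i = Suc j" "2 \<le> j" using q by (cases i) auto
    have eq: "P i q = P j q * (x j * Q j q)" using P_Suc R q j by simp
    show ?thesis unfolding eq
    proof (rule cell_idempotent)
      show "P j q \<in> I'" "x j * Q j q \<in> I'" using P_in Q_in in_I' R q j by simp_all
      show "P j q * (x j * Q j q) \<notin> I" using P_notin[OF R(1,2), of q i] eq q by simp
      show "x j * Q j q * P j q \<notin> I"
        using b[of "x j" j] input_notin[OF R(1,2), of q j] q j qa by (simp add: mult.assoc)
    qed
  qed
qed

text \<open>Agreement up to column 3 makes the longer prefix survive there too, so in column 3 the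
  states of the rows after \<open>r\<close> are idempotents. They form a left zero band of right
  units for the partial products and stay fixed up to column \<open>l\<close>, so the rows from
  \<open>R\<close> to \<open>R'\<close> contribute nothing.\<close>

lemma columns_agree:
  assumes R: "r + 3 \<le> R" "R < R'" "R' \<le> n" "Q l R \<notin> I"
    and first: "\<And>i. i \<le> 3 \<Longrightarrow> Q i R' = Q i R"
  shows "Q l R' = Q l R"
proof (cases "l \<le> 3")
  case False
  then have l: "3 < l" by simp
  have Rn: "R \<le> n" using R by simp
  have "Q 3 R \<notin> I" using Q_notin_earlier[OF R(4) Rn R(1), of 3] l by simp
  then have Q3: "Q 3 R' \<notin> I" using first by simp
  have R'r: "r + 3 \<le> R'" using R by simp
  define e where "e = P 3"
  have e_idem: "e q * e q = e q" if "r < q" "q < R'" for q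
    unfolding e_def using P_idempotent[OF Q3 R(3) R'r] that by simp
  have e_J: "e q \<in> I'" "e q \<notin> I" if "r < q" "q < R'" for q
    unfolding e_def using P_notin[OF Q3 R(3), of q 3] P_in[of 3 q] R that by simp_all
  have Q3_unit: "Q 3 (Suc q) = Q 3 q" if "r < q" "q < R'" for q
  proof -
    have "Q 3 q * e q = Q 3 (Suc q)" unfolding e_def using Q_Suc that R by simp
    moreover have "Q 3 (Suc q) \<notin> I" using Q_notin_prefix[OF Q3, of "Suc q"] that R by simp
    moreover have "Q 3 q \<in> I'" using Q_in[of 3 q] that R by simp
    ultimately show ?thesis
      using idempotent_right_unit[of "Q 3 q" "e q"] e_J e_idem that by simp
  qed
  define g where "g = Q 3 (Suc r)"
  have Q3_const: "Q 3 q = g" if "Suc r \<le> q" "q \<le> R'" for q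
    using that by (induction q rule: dec_induct) (auto simp: g_def Q3_unit)
  have ge: "g * e q = g" if "r < q" "q < R'" for q
    using Q_Suc[of q 3] Q3_const[of q] Q3_const[of "Suc q"] that R by (simp add: e_def)
  have g: "g \<notin> I" using Q3 Q3_const[of R'] R by simp
  \<comment> \<open>Each \<open>e q\<close> is a left multiple of \<open>g\<close>, which every
    \<open>e q'\<close> fixes.\<close>
  have ee: "e q * e q' = e q" if "r < q" "q < R'" "r < q'" "q' < R'" for q q'
  proof -
    have "e q \<in> I'" "g * e q \<notin> I" using e_J ge g that by auto
    then obtain s where "s * (g * e q) = e q" using L_stable by blast
    then have s: "s * g = e q" using ge that by simp
    show ?thesis unfolding s[symmetric] using ge[of q'] that by (simp add: mult.assoc)
  qed
  have "(\<forall>q. r < q \<and> q < R' \<longrightarrow> P i q = e q) \<and> (\<forall>q. r < q \<and> q \<le> R' \<longrightarrow> Q i q = Q i (Suc r))"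
    if "3 \<le> i" "i \<le> l" for i
    using that
  proof (induction i rule: dec_induct)
    case base
    then show ?case using Q3_const e_def R by auto
  next
    case (step i)
    let ?b = "Suc r"
    define y where "y = x i * Q i ?b"
    have b: "r < ?b" "?b < R" "?b < R'" using R by auto
    have i: "3 \<le> i" "i < l" using step.hyps step.prems by auto
    have IH: "P i q = e q" "Q i q = Q i ?b" if "r < q" "q < R'" for q
      using step.IH[OF less_imp_le[OF i(2)]] that less_imp_le by blast+
    have P: "P (Suc i) q = e q * y" if "r < q" "q < R'" for q
      using P_Suc[of q i] IH[OF that] that R by (simp add: y_def)
    \<comment> \<open>Row \<open>Suc r\<close> lies before \<open>R\<close>, where survival to
      column \<open>l\<close> is assumed, so its state cannot change; the left zero law carries this
      over to the rows beyond \<open>R\<close>.\<close>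
    have y: "e ?b * y = e ?b"
      using idempotent_constant[OF R(4) Rn, of ?b i] P_idempotent[OF R(4) Rn R(1), of ?b "Suc i"]
        P_idempotent[OF R(4) Rn R(1), of ?b i] i b P[of ?b] IH(1)[of ?b] by simp
    have P': "P (Suc i) q = e q" if "r < q" "q < R'" for q
    proof -
      have "e q * e ?b * y = e q * e ?b" by (simp add: mult.assoc y)
      then show ?thesis using P[OF that] ee[OF that b(1,3)] by simp
    qed
    define G where "G = Q (Suc i) ?b"
    have "G * e ?b = Q (Suc i) (Suc ?b)" unfolding G_def using Q_Suc[of ?b "Suc i"] P' b R by simp
    moreover have "Q (Suc i) (Suc ?b) \<notin> I"
      using Q_notin_prefix[of "Suc i" R "Suc ?b"] Q_notin_earlier[OF R(4) Rn R(1), of "Suc i"] i b Rn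
      by simp
    moreover have "G \<in> I'" unfolding G_def using Q_in[of "Suc i" ?b] b R by simp
    ultimately have Gb: "G * e ?b = G" 
      using idempotent_right_unit[of G "e ?b"] e_J[OF b(1,3)] e_idem[OF b(1,3)] by simp
    have Ge: "G * e q = G" if "r < q" "q < R'" for q
    proof -
      have "G * e ?b * e q = G * e ?b" by (simp add: mult.assoc ee[OF b(1,3) that])
      then show ?thesis using Gb by simp
    qed
    have "Q (Suc i) q = G" if "Suc r \<le> q" "q \<le> R'" for q
      using that
    proof (induction q rule: dec_induct)
      case (step q)
      then show ?case using Q_Suc[of q "Suc i"] P'[of q] Ge[of q] R by simp
    qed (simp add: G_def)
    then show ?case using P' Suc_leI unfolding G_def by blast
  qed
  then have "Q l q = Q l (Suc r)" if "r < q" "q \<le> R'" for q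
    using less_imp_le[OF l] that by blast
  from this[of R] this[of R'] show ?thesis using R by simp
qed (use first in simp)

end

section \<open>Finiteness for monoids\<close>

text \<open>Histories list the latest letter first, so \<open>c\<close> ends at a moment when
  \<open>p\<close> has just become true.\<close>

lemma exists_shortest_suffix:
  assumes "p u"
  obtains y c where "u = y @ c" "p c" "c = [] \<or> \<not> p (tl c)"
  using assms
proof (induction u arbitrary: thesis)
  case (Cons a u)
  show ?case
  proof (cases "p u")
    case True
    show ?thesis by (rule Cons.IH[OF _ True]) (use Cons.prems(1)[of "a # _"] in simp)
  next
    case False
    then show ?thesis using Cons.prems(1)[of "[]" "a # u"] Cons.prems(2) by simp
  qed
qed auto

lemma exists_large_fibre:
  fixes f :: "nat \<Rightarrow> 'b"
  assumes "finite F" "f ` {..n} \<subseteq> F" "k * card F \<le> n"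
  obtains d where "k < card {i \<in> {..n}. f i = d}"
proof (rule ccontr)
  assume "\<not> thesis"
  then have small: "card {i \<in> {..n}. f i = d} \<le> k" for d using that not_le by blast
  have "{..n} = (\<Union>d\<in>F. {i \<in> {..n}. f i = d})" using assms(2) by auto
  then have "card {..n} \<le> (\<Sum>d\<in>F. card {i \<in> {..n}. f i = d})"
    using card_UN_le[OF assms(1)] by metis
  also have "\<dots> \<le> card F * k" using sum_bounded_above[of F _ k] small by auto
  finally show False using assms(3) by (simp add: mult.commute)
qed

context J_layer
begin

text \<open>The array starts at a moment when the product of the prefix of length \<open>R\<close>
  enters \<open>I'\<close>. By congruence modulo \<open>I'\<close> the prefix of length
  \<open>r\<close> is then in \<open>I'\<close> too, so one column later all rows from
  \<open>r\<close> on have states in \<open>I'\<close>.\<close>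

lemma prefixes_agree:
  assumes r: "r + 3 \<le> R" "R < R'" "R' \<le> length w"
    and prefix: "collapsed_prod I' (take r w) = collapsed_prod I' (take R w)"
      "collapsed_prod I' (take R w) = collapsed_prod I' (take R' w)"
    and first: "\<And>v y. v = [] \<or> sect_prod (take R w) v \<notin> I' \<and> sect_prod (take R' w) v \<notin> I'
      \<Longrightarrow> length y \<le> 4 \<Longrightarrow> sect_prod (take R w) (y @ v) = sect_prod (take R' w) (y @ v)"
  shows "collapsed_prod I (take R w) = collapsed_prod I (take R' w)"
proof (rule ext)
  fix u
  define S where "S q = sect_prod (take q w)" for q
  have in_iff: "S r u \<in> I' \<longleftrightarrow> S R u \<in> I'" "S R u \<in> I' \<longleftrightarrow> S R' u \<in> I'" for u
    unfolding S_def by (rule collapsed_prod_eqD(1)[OF prefix(1)], rule collapsed_prod_eqD(1)[OF prefix(2)])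
  show "collapsed_prod I (take R w) u = collapsed_prod I (take R' w) u"
  proof (cases "S R u \<in> I'")
    case False
    then have "S R u = S R' u"
      unfolding S_def by (rule collapsed_prod_eqD(2)[OF prefix(2)])
    then show ?thesis by (simp add: collapsed_prod_def S_def)
  next
    case True
    then obtain y c where u: "u = y @ c" and c: "S R c \<in> I'" "c = [] \<or> S R (tl c) \<notin> I'"
      by (rule exists_shortest_suffix)
    obtain z v where z: "c = z @ v" "length z \<le> 1" and v: "v = [] \<or> S R v \<notin> I'"
    proof
      show "c = take 1 c @ tl c" "length (take 1 c) \<le> 1" by (cases c; simp)+
      show "tl c = [] \<or> S R (tl c) \<notin> I'" using c(2) by auto
    qed
    define x where "x i = rev y ! i" for i
    define col where "col i = rev (map x [0..<i]) @ c" for i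
    have col_y: "col (length y) = u"
      unfolding col_def x_def u using map_nth[of "rev y"] by simp
    have col_Suc: "col (Suc i) = x i # col i" for i by (simp add: col_def)
    interpret section_array type I I' x "\<lambda>i q. sect w (col i) ! q" "\<lambda>i q. S q (col i)" "length w" r
    proof
      show "sect w (col (Suc i)) ! q = sect w (col i) ! q * (x i * S q (col i))" if "q < length w" for i q
        using nth_sect_Cons[OF that] by (simp add: S_def col_Suc mult.assoc del: sect_Cons)
      show "S (Suc q) (col i) = S q (col i) * sect w (col i) ! q" if "q < length w" for i q
        using sect_prod_take_Suc[OF that] by (simp add: S_def)
      show "S r (col 0) \<in> I'" using c in_iff by (simp add: col_def)
    qed
    \<comment> \<open>Columns 0 to 3 lie at most three letters after \<open>c\<close>, and
      \<open>c\<close> at most one after \<open>v\<close>: hence the bound 4 in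
      \<open>first\<close>.\<close>
    have "S R' (col i) = S R (col i)" if "i \<le> 3" for i
    proof -
      have col_i: "col i = (rev (map x [0..<i]) @ z) @ v" by (simp add: col_def z(1))
      have "S R (col i) = S R' (col i)"
        unfolding S_def col_i
        by (rule first) (use v z(2) that in_iff(2)[of v] in \<open>auto simp: S_def\<close>)
      then show ?thesis by (rule sym)
    qed
    then have "S R' u = S R u" if "S R u \<notin> I"
      using columns_agree[of R R' "length y"] r that by (simp add: col_y)
    moreover have "S R' u \<in> I" if "S R u \<in> I"
      using Q_notin_prefix[where i = "length y" and q' = R' and q = R] r that by (auto simp: col_y)
    ultimately show ?thesis unfolding collapsed_prod_def S_def collapse_eq_iff by metis
  qed
qed

text \<open>A pumping argument: cutting out the factor between two congruent prefixes shortens a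
  long word without changing its class, so words of bounded length represent all classes.\<close>

lemma finite_index_layer:
  assumes "finite (range (collapsed_prod I'))"
  shows "finite (range (collapsed_prod I))"
proof -
  obtain D :: "'a list \<Rightarrow> ((('a \<times> ('a list \<Rightarrow> 'a)) \<Rightarrow> 'a) \<times> 'a list) \<Rightarrow> 'a"
    where D: "finite (range D)"
      "\<And>w w' v y. D w = D w' \<Longrightarrow> v = [] \<or> sect_prod w v \<notin> I' \<and> sect_prod w' v \<notin> I' \<Longrightarrow> length y \<le> 4
        \<Longrightarrow> sect_prod w (y @ v) = sect_prod w' (y @ v)"
    using finite_index_extensions[OF ideal' assms, where n = 4] by blast
  define F where "F = range (collapsed_prod I') \<times> range D"
  have F: "finite F" unfolding F_def using assms D by simp
  \<comment> \<open>A longer word has at least five prefixes with the same data in \<open>F\<close>.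
    The first, the last but one and the last become \<open>r\<close>, \<open>R\<close> and
    \<open>R'\<close>, which ensures \<open>r + 3 \<le> R\<close>.\<close>
  define B where "B = 4 * card F"
  have "\<exists>w'. length w' \<le> B \<and> collapsed_prod I w' = collapsed_prod I w" for w
  proof (induction w rule: length_induct)
    case (1 w)
    show ?case
    proof (cases "length w \<le> B")
      case False
      define f where "f k = (collapsed_prod I' (take k w), D (take k w))" for k
      have "f ` {..length w} \<subseteq> F" "4 * card F \<le> length w"
        unfolding f_def F_def using False by (auto simp: B_def F_def)
      then obtain d where d: "4 < card {k \<in> {..length w}. f k = d}"
        by (rule exists_large_fibre[OF F])
      define C where "C = {k \<in> {..length w}. f k = d}"
      define R' where "R' = Max C"
      define R where "R = Max (C - {R'})"
      define r where "r = Min C"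
      have C: "finite C" "4 < card C" using d unfolding C_def by simp_all
      then have "C \<noteq> {}" by force
      then have R': "R' \<in> C" and r: "r \<in> C" unfolding R'_def r_def using C by simp_all
      have card4: "4 \<le> card (C - {R'})" using C R' by simp
      then have "C - {R'} \<noteq> {}" by (metis card.empty not_numeral_le_zero)
      then have R: "R \<in> C - {R'}" unfolding R_def by (intro Max_in) (simp_all add: C(1))
      have "C - {R'} \<subseteq> {r..R}"
      proof
        fix q assume q: "q \<in> C - {R'}"
        then have "r \<le> q" unfolding r_def using C(1) by (intro Min_le) simp_all
        moreover have "q \<le> R" unfolding R_def using C(1) q by (intro Max_ge) simp_all
        ultimately show "q \<in> {r..R}" by simp
      qed
      from card_mono[OF _ this] have "r + 3 \<le> R" using card4 by simp
      moreover have "R < R'" using R Max_ge[OF C(1), of R] unfolding R'_def by (simp add: order_less_le)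
      moreover have f: "f r = f R" "f R = f R'" "R' \<le> length w" using r R R' unfolding C_def by simp_all
      ultimately have less: "r + 3 \<le> R" "R < R'" "R' \<le> length w" by simp_all
      have "D (take R w) = D (take R' w)" using f(2) by (simp add: f_def)
      from D(2)[OF this] have "collapsed_prod I (take R w) = collapsed_prod I (take R' w)"
        using f(1,2) by (intro prefixes_agree[OF less]) (simp_all add: f_def)
      then have "collapsed_prod I (take R w @ drop R' w) = collapsed_prod I w"
        using collapsed_prod_append[OF ideal, of "take R w" "take R' w" "drop R' w"] by simp
      moreover have "length (take R w @ drop R' w) < length w" using less by simp
      ultimately show ?thesis using 1[rule_format, of "take R w @ drop R' w"] by simp
    qed blast
  qed
  then have short: "\<exists>w'. length w' \<le> B \<and> collapsed_prod I w' = collapsed_prod I w" for w by blast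
  have "range (collapsed_prod I) \<subseteq> collapsed_prod I ` {w. set w \<subseteq> UNIV \<and> length w \<le> B}"
  proof
    fix h assume "h \<in> range (collapsed_prod I)"
    then obtain w' where "length w' \<le> B" "h = collapsed_prod I w'" using short by (auto dest: sym)
    then show "h \<in> collapsed_prod I ` {w. set w \<subseteq> UNIV \<and> length w \<le> B}" by simp
  qed
  then show ?thesis by (rule finite_subset) (intro finite_imageI finite_lists_length_le finite)
qed

end

context aperiodic_R_unipotent
begin

lemma finite_index_ideal:
  fixes I :: "'a set"
  assumes "ideal I"
  shows "finite (range (collapsed_prod I))"
  using assms
proof (induction "card (- I)" arbitrary: I rule: less_induct)
  case less
  show ?case
  proof (cases "I = UNIV")
    case True
    then have "collapsed_prod I w = (\<lambda>u. SOME z. z \<in> I)" for w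
      by (simp add: collapsed_prod_def collapse_def fun_eq_iff)
    then have "range (collapsed_prod I) \<subseteq> {\<lambda>u. SOME z. z \<in> I}" by auto
    then show ?thesis by (rule finite_subset) simp
  next
    case False
    define p where "p a = {s * a * t | s t. True}" for a :: 'a
    have p_self: "a \<in> p a" for a unfolding p_def by (rule CollectI) (metis mult_1_left mult_1_right)
    have p_mult: "x * b * y \<in> p a" if "b \<in> p a" for x y a b
    proof -
      obtain s t where "b = s * a * t" using \<open>b \<in> p a\<close> unfolding p_def by blast
      then have "x * b * y = (x * s) * a * (t * y)" by (simp add: mult.assoc)
      then show ?thesis unfolding p_def by blast
    qed
    have p_sub: "p b \<subseteq> p a" if "b \<in> p a" for a b
      using p_mult[OF that] unfolding p_def[of b] by blast
    \<comment> \<open>Minimality makes every element of \<open>p a\<close> outside \<open>I\<close>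
      generate all of \<open>p a\<close>, so the new layer is a single J-class.\<close>
    obtain a where a: "a \<notin> I" "\<And>b. b \<notin> I \<Longrightarrow> card (p a) \<le> card (p b)"
      using ex_has_least_nat[of "\<lambda>a. a \<notin> I" _ "\<lambda>a. card (p a)"] False by blast
    define I' where "I' = I \<union> p a"
    have p_eq: "p b = p a" if "b \<in> I'" "b \<notin> I" for b
      using that a(2)[of b] p_sub[of b a] card_seteq[of "p a" "p b"] unfolding I'_def by auto
    have p_ideal: "ideal (p a)"
      unfolding ideal_def using p_mult[of _ a _ 1] p_mult[of _ a 1] by simp
    interpret J_layer type I I'
    proof
      show "ideal I" by (rule less)
      then show "ideal I'" using p_ideal by (auto simp: ideal_def I'_def)
      fix b c assume "b \<in> I'" "b \<notin> I" "c \<in> I'" "c \<notin> I"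
      then have "b \<in> p c" using p_eq p_self by metis
      then show "\<exists>s t. b = s * c * t" unfolding p_def by blast
    qed
    have "- I' \<subset> - I" using a(1) p_self unfolding I'_def by auto
    then have "finite (range (collapsed_prod I'))"
      using less(1) ideal' psubset_card_mono by (metis finite)
    then show ?thesis by (rule finite_index_layer)
  qed
qed

lemma finite_range_sect_prod: "finite (range (sect_prod :: 'a list \<Rightarrow> _))"
proof -
  have "collapsed_prod {} = (sect_prod :: 'a list \<Rightarrow> _)"
    by (simp add: fun_eq_iff collapsed_prod_def collapse_def)
  then show ?thesis using finite_index_ideal[of "{}"] by (simp add: ideal_def)
qed

end

section \<open>Adjoining an identity\<close>

datatype 'a adj = One | El 'a

lemma inj_El: "inj El"
  by (simp add: inj_def)

instantiation adj :: (semigroup_mult) monoid_mult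
begin

definition one_adj :: "'a adj"
  where "one_adj = One"

fun times_adj :: "'a adj \<Rightarrow> 'a adj \<Rightarrow> 'a adj"
  where
    "times_adj One y = y"
  | "times_adj (El a) One = El a"
  | "times_adj (El a) (El b) = El (a * b)"

instance
proof
  fix a b c :: "'a adj"
  show "a * b * c = a * (b * c)"
    by (cases a; cases b; cases c) (simp_all add: mult.assoc)
  show "1 * a = a" "a * 1 = a"
    by (cases a; simp add: one_adj_def)+
qed

end

instance adj :: (finite) finite
proof
  have "x \<in> insert One (range El)" for x :: "'a adj" by (cases x) auto
  then have "(UNIV :: 'a adj set) = insert One (range El)" by blast
  then show "finite (UNIV :: 'a adj set)" by (metis finite_imageI finite_insert finite)
qed

text \<open>Exponents are shifted by one: \<open>spow x n\<close> is the power of \<open>x\<close> with exponent \<open>n + 1\<close>.\<close>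

primrec spow :: "'a::semigroup_mult \<Rightarrow> nat \<Rightarrow> 'a"
  where
    "spow x 0 = x"
  | "spow x (Suc n) = spow x n * x"

lemma spow_add: "spow x m * spow x n = spow x (Suc (m + n))"
  by (induction n) (simp_all flip: mult.assoc)

lemma spow_left: "x * spow x n = spow x (Suc n)"
  using spow_add[of x 0 n] by simp

lemma El_power: "El x ^ Suc n = El (spow x n)"
  by (induction n) (simp_all only: power_Suc2 power_0 mult_1_left spow.simps times_adj.simps)

lemma spow_cycle:
  fixes x :: "'a::{finite,semigroup_mult}"
  obtains i k where "spow x (Suc (i + k)) = spow x i"
proof -
  have "\<not> inj (spow x)" using finite_imageD[of "spow x" UNIV] by auto
  then obtain i j where "i \<noteq> j" "spow x i = spow x j" unfolding inj_def by blast
  then show ?thesis using that[of i "j - Suc i"] that[of j "i - Suc j"] by (cases i j rule: linorder_cases) simp_all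
qed

section \<open>Green's relation H and powers\<close>

lemma principal_right_ideal_mono: "a = b * t \<Longrightarrow> principal_right_ideal a \<subseteq> principal_right_ideal b"
  by (auto simp: principal_right_ideal_def mult.assoc)

lemma principal_left_ideal_mono: "a = t * b \<Longrightarrow> principal_left_ideal a \<subseteq> principal_left_ideal b"
  by (auto simp: principal_left_ideal_def simp flip: mult.assoc)

lemma green_HI:
  assumes "b = a * s" "a = b * t" "b = s' * a" "a = t' * b"
  shows "(a, b) \<in> green_H"
proof -
  have "principal_right_ideal a = principal_right_ideal b"
    by (intro subset_antisym principal_right_ideal_mono[OF assms(1)] principal_right_ideal_mono[OF assms(2)])
  moreover have "principal_left_ideal a = principal_left_ideal b"
    by (intro subset_antisym principal_left_ideal_mono[OF assms(3)] principal_left_ideal_mono[OF assms(4)])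
  ultimately show ?thesis by (simp add: green_H_def green_L_def green_R_def)
qed

lemma green_HE:
  assumes "(a, b) \<in> green_H" "a \<noteq> b"
  obtains s t where "b = a * s" "a = t * b"
proof -
  have "b \<in> principal_right_ideal a" "a \<in> principal_left_ideal b"
    using assms(1)
    by (auto simp: green_H_def green_L_def green_R_def principal_left_ideal_def principal_right_ideal_def)
  then show ?thesis
    using assms(2) that by (auto simp: principal_left_ideal_def principal_right_ideal_def)
qed

lemma green_H_refl: "(a, a) \<in> green_H"
  by (simp add: green_H_def green_L_def green_R_def)

text \<open>H-triviality of a finite semigroup is aperiodicity. Along a longer cycle of powers,
  \<open>spow x i\<close> and \<open>spow x (Suc i)\<close> are multiples of each other on both
  sides; conversely, H-related \<open>a\<close> and \<open>b\<close> give
  \<open>a = t * a * s\<close>, which iterates until \<open>t\<close> is absorbed.\<close>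

lemma green_H_trivial_iff:
  "(green_H :: 'a::{finite,semigroup_mult} rel) = Id \<longleftrightarrow> (\<forall>x :: 'a. \<exists>n. spow x n = spow x (Suc n))"
proof
  assume H: "(green_H :: 'a rel) = Id"
  show "\<forall>x :: 'a. \<exists>n. spow x n = spow x (Suc n)"
  proof
    fix x :: 'a
    obtain i k where k: "spow x (Suc (i + k)) = spow x i" by (rule spow_cycle)
    show "\<exists>n. spow x n = spow x (Suc n)"
    proof (cases k)
      case 0
      then show ?thesis using k by (intro exI[of _ i]) simp
    next
      case (Suc m)
      have "(spow x i, spow x (Suc i)) \<in> green_H"
        by (rule green_HI[of _ _ x "spow x m" x "spow x m"])
          (use k Suc in \<open>simp_all only: spow_left spow_add spow.simps(2)[symmetric] add_Suc add_Suc_right add.commute\<close>)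
      then show ?thesis using H by (intro exI[of _ i]) auto
    qed
  qed
next
  assume ap: "\<forall>x :: 'a. \<exists>n. spow x n = spow x (Suc n)"
  have "a = b" if "(a, b) \<in> green_H" for a b :: 'a
  proof (rule ccontr)
    assume "a \<noteq> b"
    with that obtain s t where st: "b = a * s" "a = t * b" by (rule green_HE)
    obtain n where n: "spow t n = spow t (Suc n)" using ap by blast
    have tas: "t * (a * s) = a" unfolding st(1)[symmetric] by (rule st(2)[symmetric])
    have a: "spow t k * a * spow s k = a" for k
    proof (induction k)
      case (Suc k)
      have "spow t (Suc k) * a * spow s (Suc k) = spow t k * (t * (a * s)) * spow s k"
        unfolding spow_left[of s k, symmetric] by (simp add: mult.assoc)
      then show ?case by (simp only: tas Suc)
    qed (simp add: tas mult.assoc)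
    have "t * a = t * (spow t n * a * spow s n)" by (simp only: a)
    also have "\<dots> = spow t (Suc n) * a * spow s n" by (simp only: spow_left mult.assoc[symmetric])
    also have "\<dots> = a" by (simp only: n[symmetric] a)
    finally have "t * a * s = a * s" by simp
    then have "a * s = a" by (simp only: tas mult.assoc)
    with \<open>a \<noteq> b\<close> st(1) show False by simp
  qed
  then show "(green_H :: 'a rel) = Id" using green_H_refl by auto
qed

lemma aperiodic_R_unipotent_adj:
  assumes "(green_H :: 'a::{finite,semigroup_mult} rel) = Id"
    and "\<not> (\<exists>T :: 'a set. subsemigroup T \<and> right_zero T \<and> card T > 1)"
  shows "aperiodic_R_unipotent TYPE('a adj)"
proof
  fix x :: "'a adj"
  show "\<exists>n. x ^ n = x ^ Suc n"
  proof (cases x)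
    case One
    then show ?thesis by (intro exI[of _ 0]) (simp add: one_adj_def)
  next
    case (El a)
    obtain n where "spow a n = spow a (Suc n)" using assms(1) green_H_trivial_iff by blast
    then have "x ^ Suc n = x ^ Suc (Suc n)" by (simp only: El El_power)
    then show ?thesis by blast
  qed
next
  fix e f :: "'a adj"
  assume ef: "e * e = e" "f * f = f" "e * f = f" "f * e = e"
  show "e = f"
  \<comment> \<open>Two distinct \<open>El\<close> elements would form a right zero band in
    \<open>S\<close>; if one of the two is \<open>One\<close>, the equations force the other to be
    \<open>One\<close>.\<close>
  proof (cases e; cases f)
    fix a b assume ab: "e = El a" "f = El b"
    then have "subsemigroup {a, b}" "right_zero {a, b}"
      using ef by (auto simp: subsemigroup_def right_zero_def)
    then have "\<not> card {a, b} > 1" using assms(2) by blast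
    then show ?thesis using ab by (cases "a = b") auto
  qed (use ef in auto)
qed

section \<open>Words of states acting on streams\<close>

lemma stream_eq_iff: "s = s' \<longleftrightarrow> (\<forall>i. s !! i = s' !! i)"
  using smap_alt[of id s s'] by (simp add: stream.map_id)

lemma dual_cayley_state_SCons:
  "dual_cayley_state s (x ## xs) = x * s ## dual_cayley_state (s * x) xs"
  unfolding dual_cayley_state_def by (subst mealy_map.code) simp

lemma fold_state_SCons:
  "fold dual_cayley_state w (x ## xs) = foldl (*) x w ## fold dual_cayley_state (residual x w) xs"
  by (induction w arbitrary: x xs) (simp_all add: dual_cayley_state_SCons)

lemma foldl_mult: "foldl (*) x w = x * prod_list w" for x :: "'a::monoid_mult"
  by (induction w arbitrary: x) (simp_all add: mult.assoc)

text \<open>This makes the transformation given by \<open>w\<close> depend on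
  \<open>sect_prod w\<close> alone; \<open>rev\<close> appears because histories list the latest
  letter first.\<close>

lemma snth_fold_state:
  fixes w :: "'a::monoid_mult list"
  shows "fold dual_cayley_state w xs !! i = xs !! i * sect_prod w (rev (stake i xs))"
proof (induction i arbitrary: w xs)
  case 0
  show ?case using fold_state_SCons[of w "shd xs" "stl xs"] by (simp add: foldl_mult sect_prod_def)
next
  case (Suc i)
  show ?case
    using fold_state_SCons[of w "shd xs" "stl xs"] Suc[of "residual (shd xs) w" "stl xs"]
    by (simp add: sect_prod_append)
qed

lemma foldl_El: "foldl (*) (El s) (map El w) = El (foldl (*) s w)"
  by (induction w arbitrary: s) simp_all

lemma dual_cayley_state_El: "dual_cayley_state (El s) (smap El xs) = smap El (dual_cayley_state s xs)"
  unfolding stream_eq_iff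
  by (simp add: snth_dual_cayley_state stake_smap foldl_El)

lemma fold_state_El: "fold dual_cayley_state (map El w) (smap El xs) = smap El (fold dual_cayley_state w xs)"
  by (induction w arbitrary: xs) (simp_all add: dual_cayley_state_El)

lemma generated_fold:
  assumes "f \<in> generated_transformations (range g)"
  shows "\<exists>w. f = fold g w"
  using assms
proof induction
  case (generator f)
  then obtain s where "f = fold g [s]" by auto
  then show ?case by blast
next
  case (product f h)
  then obtain w z where "h \<circ> f = fold g (w @ z)" by auto
  then show ?case by blast
qed

text \<open>Words over \<open>S\<close> act on streams over \<open>S\<close> as they do inside the
  enlarged monoid, and \<open>smap El\<close> is injective; so finitely many functions
  \<open>sect_prod\<close> leave finitely many transformations.\<close>

lemma finite_dual_cayley_semigroup:
  assumes "(green_H :: 'a::{finite,semigroup_mult} rel) = Id"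
    and "\<not> (\<exists>T :: 'a set. subsemigroup T \<and> right_zero T \<and> card T > 1)"
  shows "finite (dual_cayley_semigroup :: ('a stream \<Rightarrow> 'a stream) set)"
proof -
  interpret aperiodic_R_unipotent "TYPE('a adj)" by (rule aperiodic_R_unipotent_adj[OF assms])
  have "sect_prod (map El w) = sect_prod (map El w') \<Longrightarrow> fold dual_cayley_state w = fold dual_cayley_state w'"
    for w w' :: "'a list"
  proof
    fix xs
    assume "sect_prod (map El w) = sect_prod (map El w')"
    then have "fold dual_cayley_state (map El w) (smap El xs) = fold dual_cayley_state (map El w') (smap El xs)"
      unfolding stream_eq_iff snth_fold_state by simp
    then show "fold dual_cayley_state w xs = fold dual_cayley_state w' xs"
      unfolding fold_state_El by (rule injD[OF stream.inj_map[OF inj_El]])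
  qed
  moreover have "finite (range (\<lambda>w :: 'a list. sect_prod (map El w)))"
    using finite_range_sect_prod by (rule rev_finite_subset) auto
  ultimately have "finite (range (fold (dual_cayley_state :: 'a \<Rightarrow> _)))"
    by (rule finite_range_factor[rotated])
  moreover have "dual_cayley_semigroup \<subseteq> range (fold (dual_cayley_state :: 'a \<Rightarrow> _))"
    unfolding dual_cayley_semigroup_def by (auto dest: generated_fold)
  ultimately show ?thesis by (rule finite_subset[rotated])
qed

section \<open>States of infinite order\<close>

lemma funpow_Suc_in_dual_cayley_semigroup:
  "(dual_cayley_state s ^^ Suc n) \<in> dual_cayley_semigroup"
proof (induction n)
  case 0
  show ?case by (simp add: dual_cayley_semigroup_def generated_transformations.generator)
next
  case (Suc n)
  then show ?case
    unfolding dual_cayley_semigroup_def funpow.simps(2)[of "Suc n"]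
    by (rule generated_transformations.product[OF _ generated_transformations.generator]) simp
qed

lemma funpow_eq_if_finite:
  assumes "finite (dual_cayley_semigroup :: ('a::semigroup_mult stream \<Rightarrow> 'a stream) set)"
  obtains n k where "n < k" "dual_cayley_state (s :: 'a) ^^ n = dual_cayley_state s ^^ k"
proof -
  \<comment> \<open>The exponents are positive because only nonempty products are generated.\<close>
  have "range (\<lambda>n. dual_cayley_state s ^^ Suc n) \<subseteq> dual_cayley_semigroup"
    using funpow_Suc_in_dual_cayley_semigroup by blast
  then have "\<not> inj (\<lambda>n. dual_cayley_state s ^^ Suc n)"
    using assms finite_subset finite_imageD infinite_UNIV_nat by blast
  then obtain n k where "n \<noteq> k" "dual_cayley_state s ^^ Suc n = dual_cayley_state s ^^ Suc k"
    unfolding inj_def by blast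
  then show ?thesis
    using that[of "Suc n" "Suc k"] that[of "Suc k" "Suc n"] by (cases "n < k") auto
qed

text \<open>On letters \<open>a\<close> and \<open>b\<close> the output is the current state and the
  next state is the letter just read. So \<open>dual_cayley_state a\<close> delays a stream by one
  place and puts \<open>a\<close> in front, and its powers turn the constant stream of
  \<open>b\<close> into streams with ever longer prefixes of \<open>a\<close>.\<close>

lemma infinite_if_right_zero:
  fixes a b :: "'a::semigroup_mult"
  assumes "a * a = a" "a * b = b" "b * a = a" "b * b = b" "a \<noteq> b"
  shows "infinite (dual_cayley_semigroup :: ('a stream \<Rightarrow> 'a stream) set)"
proof
  assume "finite (dual_cayley_semigroup :: ('a stream \<Rightarrow> 'a stream) set)"
  then obtain n k where nk: "n < k" "dual_cayley_state a ^^ n = dual_cayley_state a ^^ k"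
    using funpow_eq_if_finite by blast
  have b: "dual_cayley_state b (sconst b) = sconst b"
    unfolding stream_eq_iff
  proof
    fix i
    have "stake i (sconst b) = replicate i b"
      by (induction i) (simp_all only: stake.simps siterate.simps id_apply replicate.simps)
    moreover have "foldl (*) b (replicate i b) = b" by (induction i) (simp_all add: assms)
    ultimately show "dual_cayley_state b (sconst b) !! i = sconst b !! i"
      by (simp add: snth_dual_cayley_state assms)
  qed
  have a: "dual_cayley_state a (replicate m a @- sconst b) = replicate (Suc m) a @- sconst b" for m
  proof (induction m)
    case 0
    have "b ## sconst b = sconst b"
      using stream.collapse[of "sconst b"] by (simp only: siterate.simps id_apply)
    moreover have "dual_cayley_state a (b ## sconst b) = a ## sconst b"
      by (simp only: dual_cayley_state_SCons assms b)
    ultimately show ?case by (simp only: replicate.simps shift.simps)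
  next
    case (Suc m)
    then show ?case by (simp add: dual_cayley_state_SCons assms)
  qed
  have "(dual_cayley_state a ^^ m) (sconst b) = replicate m a @- sconst b" for m
  proof (induction m)
    case (Suc m)
    then show ?case by (simp only: funpow.simps o_apply a)
  qed simp
  then have "replicate n a @- sconst b = replicate k a @- sconst b" using nk by metis
  then have "(replicate n a @- sconst b) !! n = (replicate k a @- sconst b) !! n" by simp
  then show False using nk assms(5) by simp
qed

text \<open>
  On streams of powers of one group element, the state of the identity replaces exponents by their
  partial sums; it turns row \<open>j + 1\<close> of the signed Pascal triangle into row \<open>j\<close>.
\<close>

lemma alternating_partial_sum:
  "(\<Sum>k\<le>i. (- 1) ^ k * int (Suc j choose k)) = (- 1) ^ i * int (j choose i)"
  by (induction i) (simp_all add: algebra_simps)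

lemma infinite_if_hom_int:
  fixes \<phi> :: "int \<Rightarrow> 'a::semigroup_mult"
  assumes hom: "\<And>a b. \<phi> (a + b) = \<phi> a * \<phi> b" and neq: "\<phi> 1 \<noteq> \<phi> 0"
  shows "infinite (dual_cayley_semigroup :: ('a stream \<Rightarrow> 'a stream) set)"
proof
  assume "finite (dual_cayley_semigroup :: ('a stream \<Rightarrow> 'a stream) set)"
  then obtain n k where nk: "n < k" "dual_cayley_state (\<phi> 0) ^^ n = dual_cayley_state (\<phi> 0) ^^ k"
    using funpow_eq_if_finite by blast
  define F where "F = dual_cayley_state (\<phi> 0)"
  \<comment> \<open>The exponents are the coefficients of \<open>(1 - t) ^ j\<close>.\<close>
  define u where "u j = smap (\<lambda>i. \<phi> ((- 1) ^ i * int (j choose i))) (fromN 0)" for j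
  have u_nth: "u j !! i = \<phi> ((- 1) ^ i * int (j choose i))" for i j
    by (simp add: u_def)
  have F: "F (u (Suc j)) = u j" for j
    unfolding stream_eq_iff
  proof
    fix i
    let ?c = "\<lambda>k. (- 1) ^ k * int (Suc j choose k)"
    have "foldl (*) (\<phi> 0) (stake m (u (Suc j))) = \<phi> (\<Sum>k<m. ?c k)" for m
      by (induction m) (simp_all add: stake_Suc u_nth hom del: stake.simps(2))
    then have "F (u (Suc j)) !! i = \<phi> (?c i) * \<phi> (\<Sum>k<i. ?c k)"
      by (simp add: F_def snth_dual_cayley_state u_nth)
    also have "\<dots> = \<phi> (\<Sum>k\<le>i. ?c k)"
      by (simp add: add.commute flip: hom lessThan_Suc_atMost)
    finally show "F (u (Suc j)) !! i = u j !! i"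
      by (simp add: alternating_partial_sum u_nth)
  qed
  have Fn: "(F ^^ m) (u (m + j)) = u j" for m j
    by (induction m) (simp_all add: F funpow_swap1)
  have "u (k - n) = u 0"
    using Fn[of n "k - n"] Fn[of k 0] nk by (simp add: F_def)
  \<comment> \<open>Position \<open>k - n\<close> holds the last nonzero coefficient, 1 or -1, in
    \<open>u (k - n)\<close>, and 0 in \<open>u 0\<close>.\<close>
  then have "\<phi> ((- 1) ^ (k - n)) = \<phi> 0"
    using u_nth[of "k - n" "k - n"] u_nth[of 0 "k - n"] nk(1) by (simp add: binomial_eq_0)
  then have "\<phi> 1 = \<phi> 0 \<or> \<phi> (- 1) = \<phi> 0"
    by (cases "even (k - n)") simp_all
  moreover have "\<phi> 1 = \<phi> 0" if "\<phi> (- 1) = \<phi> 0"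
    using hom[of 1 "- 1"] hom[of 1 0] that by simp
  ultimately show False using neq by blast
qed

text \<open>The periodic powers of \<open>x\<close> form a cyclic group, onto which
  \<open>\<phi>\<close> maps the integers; the hypothesis keeps its generator apart from its
  identity.\<close>

lemma infinite_if_periodic:
  fixes x :: "'a::{finite,semigroup_mult}"
  assumes "\<And>n. spow x n \<noteq> spow x (Suc n)"
  shows "infinite (dual_cayley_semigroup :: ('a stream \<Rightarrow> 'a stream) set)"
proof -
  obtain i k where "spow x (Suc (i + k)) = spow x i" by (rule spow_cycle)
  then have cycle: "spow x (i + Suc k) = spow x i" by simp
  define m where "m = Suc k"
  have period: "spow x (i + n + m) = spow x (i + n)" for n
    by (induction n) (use cycle m_def in simp_all)
  have periods: "spow x (i + n + m * q) = spow x (i + n)" for n q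
  proof (induction q)
    case (Suc q)
    have "i + n + m * Suc q = i + (n + m * q) + m" by simp
    then show ?case using Suc period[of "n + m * q"] by (metis add.assoc)
  qed simp
  have cong: "spow x (i + a) = spow x (i + b)" if "a mod m = b mod m" for a b
  proof -
    have "spow x (i + c) = spow x (i + c mod m)" for c
      using periods[of "c mod m" "c div m"] by (simp add: add.assoc)
    from this[of a] this[of b] show ?thesis using that by simp
  qed
  \<comment> \<open>The true exponent of \<open>spow x (i + E)\<close> is
    \<open>i + E + 1 = m * Suc i\<close>, a multiple of the period that lies in the periodic part,
    so this power is the identity of the group.\<close>
  define E where "E = m * Suc i - Suc i"
  define \<phi> where "\<phi> z = spow x (i + (E + nat (z mod int m)))" for z
  have m: "0 < m" by (simp add: m_def)
  have "Suc i \<le> m * Suc i" unfolding m_def by simp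
  then have E: "Suc (i + E) = m * Suc i" unfolding E_def by simp
  show ?thesis
  proof (rule infinite_if_hom_int)
    fix a b
    let ?a = "nat (a mod int m)" and ?b = "nat (b mod int m)"
    have "\<phi> a * \<phi> b = spow x (i + (E + (m * Suc i + (?a + ?b))))"
    proof -
      have "Suc (i + (E + ?a) + (i + (E + ?b))) = i + (E + (Suc (i + E) + (?a + ?b)))" by simp
      then show ?thesis by (simp only: \<phi>_def spow_add E)
    qed
    also have "\<dots> = \<phi> (a + b)"
      unfolding \<phi>_def
    proof (rule cong)
      have "int ((?a + ?b) mod m) = int (nat ((a + b) mod int m) mod m)"
        using m by (simp add: zmod_int mod_add_eq)
      then have "(?a + ?b) mod m = nat ((a + b) mod int m) mod m" by (simp only: of_nat_eq_iff)
      then have "(E + (?a + ?b)) mod m = (E + nat ((a + b) mod int m)) mod m"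
        by (metis mod_add_right_eq)
      moreover have "E + (m * Suc i + (?a + ?b)) = E + (?a + ?b) + m * Suc i" by simp
      ultimately show "(E + (m * Suc i + (?a + ?b))) mod m = (E + nat ((a + b) mod int m)) mod m"
        by (simp only: mod_mult_self2)
    qed
    finally show "\<phi> (a + b) = \<phi> a * \<phi> b" by simp
  next
    have "\<phi> 1 = spow x (i + (E + 1))"
      unfolding \<phi>_def
    proof (rule cong)
      have "int (nat (1 mod int m) mod m) = int (1 mod m)" using m by (simp add: zmod_int)
      then have "nat (1 mod int m) mod m = 1 mod m" by (simp only: of_nat_eq_iff)
      then show "(E + nat (1 mod int m)) mod m = (E + 1) mod m" by (metis mod_add_right_eq)
    qed
    moreover have "\<phi> 0 = spow x (i + E)" by (simp add: \<phi>_def)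
    ultimately show "\<phi> 1 \<noteq> \<phi> 0" using assms[of "i + E"] by (metis Suc_eq_plus1 add.assoc)
  qed
qed

theorem theorem1p3:
  shows "finite (dual_cayley_semigroup :: ('a::{finite,semigroup_mult} stream \<Rightarrow> 'a stream) set) \<longleftrightarrow>
    (green_H :: 'a rel) = Id \<and>
    \<not> (\<exists>T :: 'a set. subsemigroup T \<and> right_zero T \<and> card T > 1)"
proof
  assume fin: "finite (dual_cayley_semigroup :: ('a stream \<Rightarrow> 'a stream) set)"
  have "(green_H :: 'a rel) = Id"
    unfolding green_H_trivial_iff using infinite_if_periodic fin by blast
  moreover have "\<not> (subsemigroup T \<and> right_zero T \<and> card T > 1)" for T :: "'a set"
  proof
    assume T: "subsemigroup T \<and> right_zero T \<and> card T > 1"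
    then obtain a b where "a \<in> T" "b \<in> T" "a \<noteq> b"
      using card_le_Suc0_iff_eq[of T] by (auto simp: not_le[symmetric])
    then show False using infinite_if_right_zero[of a b] T fin by (simp add: right_zero_def)
  qed
  ultimately show "(green_H :: 'a rel) = Id \<and>
    \<not> (\<exists>T :: 'a set. subsemigroup T \<and> right_zero T \<and> card T > 1)" by blast
qed (use finite_dual_cayley_semigroup in blast)

end
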